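(* Let $\mathcal{P}$ be a weakly compact family of probability measures on $\Omega=C([0,\infty);\mathbb{R}^k)$ with upper expectation $\hat{\mathbb{E}}$ and upper capacity $c$, let $Y$ be a $d$-dimensional continuous $\mathcal{P}$-semimartingale, let $Q\subset\mathbb{R}^d$ be open, and let $\tau_Q,\tau_{\overline Q}$ be the exit times of $Y$ from $Q$ and $\overline Q$. Assume that for any $\delta>0$ there is an open set $O\subset\Omega$ with $c(O)\le\delta$ such that on $O^c$, $\tau_Q$ is lower semi-continuous, $\tau_{\overline Q}$ is upper semi-continuous and $\tau_Q=\tau_{\overline Q}$. (i) If $c(\{\tau_{\overline Q}>k\})\to0$ as $k\to\infty$, then $\tau_Q$ and $\tau_{\overline Q}$ are quasi-continuous. (ii) If $\hat{\mathbb{E}}[\tau_{\overline Q}I_{\{\tau_{\overline Q}>k\}}]\to0$ as $k\to\infty$, then $\tau_Q$ and $\tau_{\overline Q}$ both belong to $L^1_C(\Omega)$.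
   Context: $\Omega=C([0,\infty);\mathbb{R}^k)$ carries the metric $\rho(\omega^1,\omega^2)=\sum_{N\ge1}2^{-N}[(\sup_{t\in[0,N]}|\omega^1_t-\omega^2_t|)\wedge1]$; $B_t(\omega)=\omega_t$, $\mathcal{F}_t=\sigma\{B_s:s\le t\}$. $\hat{\mathbb{E}}[X]=\sup_{P\in\mathcal{P}}E_P[X]$ and $c(A)=\sup_{P\in\mathcal{P}}P(A)$. A property holds q.s. if it holds $P$-a.s. for every $P\in\mathcal{P}$; random variables that coincide q.s. are not distinguished. An $(\mathcal{F}_t)$-adapted process is a $\mathcal{P}$-semimartingale if it is a semimartingale under each $P\in\mathcal{P}$. For $D\subset\mathbb{R}^d$, $\tau_D(\omega)=\inf\{t\ge0:Y_t(\omega)\in D^c\}$ (with $\inf\emptyset=\infty$). A function $X$ on $\Omega$ is quasi-continuous if for each $\varepsilon>0$ there is an open $O\subset\Omega$ with $c(O)<\varepsilon$ such that $X|_{O^c}$ is (real-valued and) continuous. $L^1_C(\Omega)$ is the completion of $C_b(\Omega)$ (bounded continuous functions) under $\|X\|_1=\hat{\mathbb{E}}[|X|]$, viewed as a subspace of the Banach space of (q.s. classes of) Borel $X$ with $\|X\|_1<\infty$. Semi-continuity of $[0,\infty]$-valued functions "on $O^c$" refers to the restriction to the metric space $O^c$: upper (lower) semi-continuity means $\limsup_{x\to x_0}f(x)\le f(x_0)$ ($\liminf_{x\to x_0}f(x)\ge f(x_0)$) for each $x_0$. *)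

theory Defs
  imports "HOL-Probability.Probability"
begin

section \<open>The path space\<close>

text \<open>
  Elements of $C([0,\infty);R^k)$ are represented by functions on all of the reals; the junk
  values at negative times are fixed to 0, so that equality of paths is equality on $[0,\infty)$.
\<close>

typedef (overloaded) ('k::finite) path =
  "{w :: real \<Rightarrow> real^'k. continuous_on {0..} w \<and> (\<forall>t<0. w t = 0)}"
  morphisms path_at Abs_path
  by (rule exI[of _ "\<lambda>_. 0"]) auto

definition sup_dist :: "real \<Rightarrow> ('k::finite) path \<Rightarrow> 'k path \<Rightarrow> real" where
  "sup_dist T w1 w2 = (SUP t\<in>{0..T}. norm (path_at w1 t - path_at w2 t))"

lemma sup_dist_upper:
  assumes "0 \<le> t" "t \<le> T"
  shows "norm (path_at w1 t - path_at w2 t) \<le> sup_dist T w1 w2"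
proof -
  have c: "continuous_on {0..T} (path_at w)" for w :: "'a path"
    using path_at[of w] by (auto intro: continuous_on_subset)
  have "compact ((\<lambda>t. norm (path_at w1 t - path_at w2 t)) ` {0..T})"
    by (intro compact_continuous_image continuous_intros c) auto
  then have "bdd_above ((\<lambda>t. norm (path_at w1 t - path_at w2 t)) ` {0..T})"
    by (intro bounded_imp_bdd_above compact_imp_bounded)
  then show ?thesis
    unfolding sup_dist_def using assms by (intro cSUP_upper) auto
qed

lemma sup_dist_least:
  assumes "0 \<le> T" "\<And>t. 0 \<le> t \<Longrightarrow> t \<le> T \<Longrightarrow> norm (path_at w1 t - path_at w2 t) \<le> C"
  shows "sup_dist T w1 w2 \<le> C"
  unfolding sup_dist_def using assms by (intro cSUP_least) auto

lemma sup_dist_nonneg: "0 \<le> T \<Longrightarrow> 0 \<le> sup_dist T w1 w2"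
  using sup_dist_upper[of 0 T w1 w2] norm_ge_zero order_trans by blast

lemma sup_dist_sym: "sup_dist T w1 w2 = sup_dist T w2 w1"
  unfolding sup_dist_def by (simp add: norm_minus_commute)

lemma sup_dist_triangle:
  assumes "0 \<le> T"
  shows "sup_dist T w1 w3 \<le> sup_dist T w1 w2 + sup_dist T w2 w3"
proof (rule sup_dist_least[OF assms])
  fix t assume t: "0 \<le> t" "t \<le> T"
  have "norm (path_at w1 t - path_at w3 t)
      \<le> norm (path_at w1 t - path_at w2 t) + norm (path_at w2 t - path_at w3 t)"
    using norm_triangle_ineq[of "path_at w1 t - path_at w2 t" "path_at w2 t - path_at w3 t"] by simp
  then show "norm (path_at w1 t - path_at w3 t) \<le> sup_dist T w1 w2 + sup_dist T w2 w3"
    using sup_dist_upper[OF t, of w1 w2] sup_dist_upper[OF t, of w2 w3] by linarith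
qed

instantiation path :: (finite) metric_space
begin

text \<open>The summation index \<open>n\<close> stands for $N - 1$, $N \ge 1$.\<close>

definition dist_path :: "'a path \<Rightarrow> 'a path \<Rightarrow> real" where
  "dist_path w1 w2 = (\<Sum>n. (1/2) ^ Suc n * min (sup_dist (real (Suc n)) w1 w2) 1)"

definition uniformity_path :: "('a path \<times> 'a path) filter" where
  "uniformity_path = (INF e\<in>{0<..}. principal {(x, y). dist x y < e})"

definition open_path :: "'a path set \<Rightarrow> bool" where
  "open_path U \<longleftrightarrow> (\<forall>x\<in>U. eventually (\<lambda>(x', y). x' = x \<longrightarrow> y \<in> U) uniformity)"

instance
proof
  have nn: "0 \<le> (1/2) ^ Suc n * min (sup_dist (real (Suc n)) x y) 1" for n and x y :: "'a path"
    by (intro mult_nonneg_nonneg) (auto simp: sup_dist_nonneg)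
  have summ: "summable (\<lambda>n. (1/2) ^ Suc n * min (sup_dist (real (Suc n)) x y) 1)" for x y :: "'a path"
  proof (rule summable_comparison_test')
    show "summable (\<lambda>n. (1/2::real) ^ Suc n)"
      by (subst summable_Suc_iff) (auto intro!: summable_geometric)
    show "norm ((1/2) ^ Suc n * min (sup_dist (real (Suc n)) x y) 1) \<le> (1/2) ^ Suc n" for n
      using nn[of n x y] by (auto intro!: mult_left_le)
  qed
  fix x y z :: "'a path"
  show "(dist x y = 0) = (x = y)"
  proof
    assume "dist x y = 0"
    then have *: "(1/2) ^ Suc n * min (sup_dist (real (Suc n)) x y) 1 = 0" for n
      unfolding dist_path_def using suminf_eq_zero_iff[OF summ[of x y]] nn by blast
    have sd: "sup_dist (real (Suc n)) x y = 0" for n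
      using *[of n] by (auto simp: min_def split: if_splits)
    have "path_at x t = path_at y t" for t
    proof (cases "t < 0")
      case True
      then show ?thesis using path_at[of x] path_at[of y] by auto
    next
      case False
      obtain n where "t \<le> real n" using real_arch_simple by blast
      then have "norm (path_at x t - path_at y t) \<le> sup_dist (real (Suc n)) x y"
        using False by (intro sup_dist_upper) auto
      then show ?thesis using sd by simp
    qed
    then show "x = y" by (simp add: path_at_inject[symmetric] fun_eq_iff)
  next
    assume "x = y"
    moreover have "sup_dist (real (Suc n)) x x = 0" for n
      unfolding sup_dist_def by (simp add: cSUP_const)
    ultimately show "dist x y = 0"
      unfolding dist_path_def by simp
  qed
  show "dist x y \<le> dist x z + dist y z"
    unfolding dist_path_def
  proof (subst suminf_add[OF summ summ], rule suminf_le)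
    fix n
    have "min (sup_dist (real (Suc n)) x y) 1
        \<le> min (sup_dist (real (Suc n)) x z) 1 + min (sup_dist (real (Suc n)) y z) 1"
      using sup_dist_triangle[of "real (Suc n)" x y z] sup_dist_sym[of "real (Suc n)" z y]
        sup_dist_nonneg[of "real (Suc n)" x z] sup_dist_nonneg[of "real (Suc n)" y z]
      by linarith
    then show "(1/2) ^ Suc n * min (sup_dist (real (Suc n)) x y) 1
        \<le> (1/2) ^ Suc n * min (sup_dist (real (Suc n)) x z) 1
          + (1/2) ^ Suc n * min (sup_dist (real (Suc n)) y z) 1"
      by (simp only: distrib_left[symmetric]) (intro mult_left_mono, auto)
  qed (rule summ, rule summable_add[OF summ summ])
qed (simp_all only: uniformity_path_def open_path_def)

end

section \<open>Weakly compact families of probability measures\<close>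

definition prob_measures :: "'a::topological_space measure set" where
  "prob_measures = {P. prob_space P \<and> sets P = sets borel}"

definition weak_topology :: "'a::topological_space measure topology" where
  "weak_topology = topology_generated_by
     {{P \<in> prob_measures. (\<integral>\<omega>. f \<omega> \<partial>P) \<in> U} | (f :: 'a \<Rightarrow> real) U.
        continuous_on UNIV f \<and> bounded (range f) \<and> open U}"

definition weakly_compact :: "'a::topological_space measure set \<Rightarrow> bool" where
  "weakly_compact \<P> \<longleftrightarrow> compactin weak_topology \<P>"

section \<open>Upper expectation, capacity and quasi-continuity\<close>

definition quasi_surely :: "'a measure set \<Rightarrow> ('a \<Rightarrow> bool) \<Rightarrow> bool" where
  "quasi_surely \<P> \<phi> \<longleftrightarrow> (\<forall>P\<in>\<P>. AE \<omega> in P. \<phi> \<omega>)"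

text \<open>
  Since random variables are only determined quasi-surely, the sets and functions that occur are
  in general only measurable up to null sets of each \<open>P\<close>; every \<open>P\<close> is therefore extended to its
  completion (which changes nothing on Borel sets). The upper expectation is that of
  \<open>[0,\<infinity>]\<close>-valued functions.
\<close>

definition upper_expectation :: "'a measure set \<Rightarrow> ('a \<Rightarrow> ennreal) \<Rightarrow> ennreal" where
  "upper_expectation \<P> X = (SUP P\<in>\<P>. \<integral>\<^sup>+\<omega>. X \<omega> \<partial>completion P)"

definition capacity :: "'a measure set \<Rightarrow> 'a set \<Rightarrow> ennreal" where
  "capacity \<P> A = (SUP P\<in>\<P>. emeasure (completion P) A)"

definition quasi_continuous :: "'a::topological_space measure set \<Rightarrow> ('a \<Rightarrow> ereal) \<Rightarrow> bool" where
  "quasi_continuous \<P> X \<longleftrightarrow>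
     (\<forall>\<epsilon>::real. \<epsilon> > 0 \<longrightarrow>
        (\<exists>U. open U \<and> capacity \<P> U < ennreal \<epsilon> \<and>
             (\<forall>\<omega>\<in>-U. \<bar>X \<omega>\<bar> \<noteq> \<infinity>) \<and> continuous_on (-U) X))"

text \<open>
  The completion of $C_b$ inside the Banach space of quasi-sure classes of Borel functions of
  finite norm is the closure of $C_b$ there. A class of finite norm has a real-valued Borel
  representative \<open>Z\<close>.
\<close>

definition in_L1C :: "'a::topological_space measure set \<Rightarrow> ('a \<Rightarrow> ereal) \<Rightarrow> bool" where
  "in_L1C \<P> X \<longleftrightarrow>
     (\<exists>Z :: 'a \<Rightarrow> real.
        Z \<in> borel_measurable borel \<and>
        quasi_surely \<P> (\<lambda>\<omega>. X \<omega> = ereal (Z \<omega>)) \<and>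
        upper_expectation \<P> (\<lambda>\<omega>. ennreal \<bar>Z \<omega>\<bar>) < \<infinity> \<and>
        (\<exists>f :: nat \<Rightarrow> 'a \<Rightarrow> real.
           (\<forall>n. continuous_on UNIV (f n) \<and> bounded (range (f n))) \<and>
           (\<lambda>n. upper_expectation \<P> (\<lambda>\<omega>. ennreal \<bar>Z \<omega> - f n \<omega>\<bar>)) \<longlonglongrightarrow> 0))"

definition upper_semicontinuous_on ::
    "'a::topological_space set \<Rightarrow> ('a \<Rightarrow> 'b::{complete_linorder}) \<Rightarrow> bool" where
  "upper_semicontinuous_on S f \<longleftrightarrow> (\<forall>x0\<in>S. Limsup (at x0 within S) f \<le> f x0)"

definition lower_semicontinuous_on ::
    "'a::topological_space set \<Rightarrow> ('a \<Rightarrow> 'b::{complete_linorder}) \<Rightarrow> bool" where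
  "lower_semicontinuous_on S f \<longleftrightarrow> (\<forall>x0\<in>S. f x0 \<le> Liminf (at x0 within S) f)"

section \<open>Semimartingales\<close>

text \<open>
  Processes and filtrations are indexed by all reals, but only times in $[0,\infty)$ matter.
\<close>

definition canonical_filtration :: "real \<Rightarrow> ('k::finite) path measure" where
  "canonical_filtration t =
     sigma UNIV (\<Union>s\<in>{0..t}. {(\<lambda>\<omega>. path_at \<omega> s) -` A | A. A \<in> sets borel})"

definition adapted :: "(real \<Rightarrow> 'a measure) \<Rightarrow> (real \<Rightarrow> 'a \<Rightarrow> 'b::topological_space) \<Rightarrow> bool" where
  "adapted F X \<longleftrightarrow> (\<forall>t\<ge>0. X t \<in> borel_measurable (F t))"

definition usual_augmentation :: "'a measure \<Rightarrow> (real \<Rightarrow> 'a measure) \<Rightarrow> real \<Rightarrow> 'a measure" where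
  "usual_augmentation P F t =
     sigma (space P)
       (\<Inter>s\<in>{t<..}. sigma_sets (space P) (sets (F s) \<union> null_sets (completion P)))"

definition cadlag :: "(real \<Rightarrow> real) \<Rightarrow> bool" where
  "cadlag x \<longleftrightarrow> (\<forall>t\<ge>0. (x \<longlongrightarrow> x t) (at_right t)) \<and> (\<forall>t>0. \<exists>l. (x \<longlongrightarrow> l) (at_left t))"

definition locally_finite_variation :: "(real \<Rightarrow> real) \<Rightarrow> bool" where
  "locally_finite_variation x \<longleftrightarrow>
     (\<forall>T\<ge>0. \<exists>C. \<forall>n (p :: nat \<Rightarrow> real). mono p \<and> range p \<subseteq> {0..T} \<longrightarrow>
        (\<Sum>i<n. \<bar>x (p (Suc i)) - x (p i)\<bar>) \<le> C)"

definition martingale :: "'a measure \<Rightarrow> (real \<Rightarrow> 'a measure) \<Rightarrow> (real \<Rightarrow> 'a \<Rightarrow> real) \<Rightarrow> bool" where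
  "martingale P F M \<longleftrightarrow>
     adapted F M \<and> (\<forall>t\<ge>0. integrable P (M t)) \<and>
     (\<forall>s t. 0 \<le> s \<and> s \<le> t \<longrightarrow> (AE \<omega> in P. real_cond_exp P (F s) (M t) \<omega> = M s \<omega>))"

text \<open>
  The localizing stopping times are taken real-valued; a localizing sequence \<open>T n\<close> with values in
  \<open>[0,\<infinity>]\<close> may be replaced by the minimum of \<open>T n\<close> and \<open>n\<close>.
\<close>

definition local_martingale ::
    "'a measure \<Rightarrow> (real \<Rightarrow> 'a measure) \<Rightarrow> (real \<Rightarrow> 'a \<Rightarrow> real) \<Rightarrow> bool" where
  "local_martingale P F M \<longleftrightarrow>
     adapted F M \<and> (\<forall>\<omega>\<in>space P. cadlag (\<lambda>t. M t \<omega>)) \<and>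
     (\<exists>T :: nat \<Rightarrow> 'a \<Rightarrow> real.
        (\<forall>n. stopping_time F (T n) \<and> (\<forall>\<omega>\<in>space P. 0 \<le> T n \<omega>)) \<and>
        (AE \<omega> in P. incseq (\<lambda>n. T n \<omega>) \<and> filterlim (\<lambda>n. T n \<omega>) at_top sequentially) \<and>
        (\<forall>n. martingale P F (\<lambda>t \<omega>. M (min t (T n \<omega>)) \<omega> - M 0 \<omega>)))"

definition semimartingale ::
    "'a measure \<Rightarrow> (real \<Rightarrow> 'a measure) \<Rightarrow> (real \<Rightarrow> 'a \<Rightarrow> real) \<Rightarrow> bool" where
  "semimartingale P F X \<longleftrightarrow>
     adapted F X \<and>
     (\<exists>M A. local_martingale P F M \<and>
        adapted F A \<and>
        (\<forall>\<omega>\<in>space P. cadlag (\<lambda>t. A t \<omega>) \<and> locally_finite_variation (\<lambda>t. A t \<omega>)) \<and>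
        (\<forall>\<omega>\<in>space P. M 0 \<omega> = 0 \<and> A 0 \<omega> = 0) \<and>
        (AE \<omega> in P. \<forall>t\<ge>0. X t \<omega> = X 0 \<omega> + M t \<omega> + A t \<omega>))"

text \<open>
  The process itself is adapted to the raw filtration; ``semimartingale under \<open>P\<close>'' is understood,
  componentwise, on the stochastic basis of \<open>P\<close> satisfying the usual conditions. For raw-adapted
  processes this is known to give the same class as decompositions adapted to the raw filtration.
\<close>

definition family_semimartingale ::
    "('k::finite) path measure set \<Rightarrow> (real \<Rightarrow> 'k path \<Rightarrow> real^'d) \<Rightarrow> bool" where
  "family_semimartingale \<P> Y \<longleftrightarrow>
     adapted canonical_filtration Y \<and>
     (\<forall>P\<in>\<P>. \<forall>i. semimartingale (completion P) (usual_augmentation P canonical_filtration)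
                  (\<lambda>t \<omega>. Y t \<omega> $ i))"

text \<open>Continuity of the paths is required quasi-surely.\<close>

definition continuous_family_semimartingale ::
    "('k::finite) path measure set \<Rightarrow> (real \<Rightarrow> 'k path \<Rightarrow> real^'d) \<Rightarrow> bool" where
  "continuous_family_semimartingale \<P> Y \<longleftrightarrow>
     family_semimartingale \<P> Y \<and>
     quasi_surely \<P> (\<lambda>\<omega>. continuous_on {0..} (\<lambda>t. Y t \<omega>))"

definition exit_time :: "(real \<Rightarrow> 'a \<Rightarrow> 'b) \<Rightarrow> 'b set \<Rightarrow> 'a \<Rightarrow> ennreal" where
  "exit_time Y D \<omega> = Inf (ennreal ` {t. 0 \<le> t \<and> Y t \<omega> \<in> -D})"

end

theory Submission
  imports Defs
begin

text \<open>
  Off an open set \<open>U\<close> of small capacity both exit times agree and are continuous as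
  \<open>[0,\<infinity>]\<close>-valued functions. Relative continuity on the closed set \<open>-U\<close> makes
  \<open>U \<union> {\<tau> > n}\<close> open, and its capacity is small for large \<open>n\<close>; off this set \<open>\<tau>\<close> is finite.
  For membership in \<open>L\<^sup>1\<^sub>C\<close>, the restriction of \<open>min \<tau> n\<close> to \<open>-U\<close> extends by Tietze to a continuous
  \<open>f\<close> with values in \<open>[0,n]\<close>, and \<open>\<bar>\<tau> - f\<bar> \<le> \<tau> 1\<^bsub>{\<tau> > n}\<^esub> + n 1\<^bsub>U\<^esub>\<close>.
\<close>

section \<open>Probability measures, semicontinuity and continuity\<close>

text \<open>Every generating set of \<open>weak_topology\<close> lies in
  \<open>prob_measures\<close>, hence so does the topspace, and a compact set is contained in the
  topspace.\<close>

lemma weakly_compact_imp_prob_measures: "weakly_compact \<P> \<Longrightarrow> \<P> \<subseteq> prob_measures"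
  unfolding weakly_compact_def weak_topology_def compactin_def by auto

text \<open>Anything strictly below \<open>f x\<close> is strictly below the Liminf, and anything
  strictly above \<open>f x\<close> is strictly above the Limsup; these two kinds of bounds describe
  convergence in an order topology.\<close>

lemma continuous_on_if_semicontinuous:
  fixes f :: "'a::topological_space \<Rightarrow> 'b::{complete_linorder,linorder_topology}"
  assumes "lower_semicontinuous_on S f" "upper_semicontinuous_on S f"
  shows "continuous_on S f"
  unfolding continuous_on_def
proof
  fix x assume "x \<in> S"
  then have "f x \<le> Liminf (at x within S) f" "Limsup (at x within S) f \<le> f x"
    using assms by (auto simp: lower_semicontinuous_on_def upper_semicontinuous_on_def)
  then show "(f \<longlongrightarrow> f x) (at x within S)"
    by (intro order_tendstoI less_LiminfD Limsup_lessD) (auto intro: less_le_trans le_less_trans)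
qed

lemma upper_semicontinuous_on_cong:
  assumes "upper_semicontinuous_on S f" "\<And>x. x \<in> S \<Longrightarrow> f x = g x"
  shows "upper_semicontinuous_on S g"
proof -
  have "Limsup (at x within S) f = Limsup (at x within S) g" for x
    by (intro Limsup_eq) (auto simp: eventually_at_filter assms(2))
  then show ?thesis
    using assms by (auto simp: upper_semicontinuous_on_def)
qed

section \<open>Capacity and quasi-sure properties\<close>

lemma prob_measuresD:
  assumes "\<P> \<subseteq> prob_measures" "P \<in> \<P>"
  shows "prob_space P" "sets P = sets borel" "space P = UNIV"
  using assms sets_eq_imp_space_eq[of P borel] by (auto simp: prob_measures_def)

lemma emeasure_le_capacity: "P \<in> \<P> \<Longrightarrow> emeasure (completion P) A \<le> capacity \<P> A"
  unfolding capacity_def by (rule SUP_upper)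

lemma emeasure_open_le_capacity:
  assumes "\<P> \<subseteq> prob_measures" "P \<in> \<P>" "open U"
  shows "emeasure P U \<le> capacity \<P> U"
  using emeasure_le_capacity[OF assms(2), of U] prob_measuresD[OF assms(1,2)] assms(3)
  by (simp add: emeasure_completion)

text \<open>Subadditivity passes to the supremum over \<open>P\<close>. Measurability is assumed
  because \<open>emeasure\<close> is 0 on non-measurable sets, where subadditivity can fail.\<close>

lemma capacity_Un_le:
  assumes "\<And>P. P \<in> \<P> \<Longrightarrow> A \<in> sets (completion P) \<and> B \<in> sets (completion P)"
  shows "capacity \<P> (A \<union> B) \<le> capacity \<P> A + capacity \<P> B"
  unfolding capacity_def[of \<P> "A \<union> B"]
proof (rule SUP_least)
  fix P assume P: "P \<in> \<P>"
  then have "emeasure (completion P) (A \<union> B) \<le> emeasure (completion P) A + emeasure (completion P) B"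
    using assms by (intro emeasure_subadditive) auto
  also have "\<dots> \<le> capacity \<P> A + capacity \<P> B"
    using P by (intro add_mono emeasure_le_capacity)
  finally show "emeasure (completion P) (A \<union> B) \<le> capacity \<P> A + capacity \<P> B" .
qed

text \<open>For splitting \<epsilon> between two exceptional sets: the weak bound comes from a
  freely chosen open set, the strict one from a limit or from
  \<open>quasi_continuous\<close>.\<close>

lemma ennreal_add_less_halves:
  assumes "a \<le> ennreal (\<epsilon>/2)" "b < ennreal (\<epsilon>/2)"
  shows "a + b < ennreal \<epsilon>"
proof -
  have "\<epsilon> > 0"
    using assms(2) by (cases "\<epsilon> > 0") (auto simp: ennreal_neg)
  have "a + b \<le> ennreal (\<epsilon>/2) + b"
    using assms(1) by (rule add_right_mono)
  also have "\<dots> < ennreal (\<epsilon>/2) + ennreal (\<epsilon>/2)"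
    using assms(2) by (simp add: ennreal_add_left_cancel_less)
  also have "\<dots> = ennreal \<epsilon>"
    using \<open>\<epsilon> > 0\<close> by (subst ennreal_plus[symmetric]) auto
  finally show ?thesis .
qed

lemma open_in_completion:
  assumes "\<P> \<subseteq> prob_measures" "P \<in> \<P>" "open U"
  shows "U \<in> sets (completion P)"
  using prob_measuresD[OF assms(1,2)] assms(3) by auto

lemma ennreal_inverse_Suc_tendsto_0: "(\<lambda>n. ennreal (inverse (real (Suc n)))) \<longlonglongrightarrow> 0"
  using tendsto_ennrealI[OF LIMSEQ_inverse_real_of_nat] by simp

text \<open>Choose such sets \<open>U n\<close> with capacity at most 1/(n+1). Every failure of
  \<phi> lies in their intersection, which is null under each \<open>P\<close>; this measurable
  cover suffices even if the set of failures is not Borel.\<close>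

lemma quasi_surely_if_off_small_open:
  assumes prob: "\<P> \<subseteq> prob_measures"
    and small: "\<And>\<delta>::real. \<delta> > 0 \<Longrightarrow>
      \<exists>U. open U \<and> capacity \<P> U \<le> ennreal \<delta> \<and> (\<forall>\<omega>\<in>-U. \<phi> \<omega>)"
  shows "quasi_surely \<P> \<phi>"
  unfolding quasi_surely_def
proof
  fix P assume P: "P \<in> \<P>"
  note pD = prob_measuresD[OF prob P]
  have "\<exists>U. open U \<and> capacity \<P> U \<le> ennreal (inverse (real (Suc n))) \<and> (\<forall>\<omega>\<in>-U. \<phi> \<omega>)" for n
    by (rule small) simp
  then obtain U where U: "\<And>n. open (U n)"
      "\<And>n. capacity \<P> (U n) \<le> ennreal (inverse (real (Suc n)))" "\<And>n \<omega>. \<omega> \<notin> U n \<Longrightarrow> \<phi> \<omega>"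
    by (metis ComplI)
  have meas: "U n \<in> sets P" for n
    using U(1) pD by auto
  have "emeasure P (\<Inter>n. U n) \<le> ennreal (inverse (real (Suc n)))" for n
  proof -
    have "emeasure P (\<Inter>n. U n) \<le> emeasure P (U n)"
      using meas by (intro emeasure_mono) auto
    also have "\<dots> \<le> ennreal (inverse (real (Suc n)))"
      using emeasure_open_le_capacity[OF prob P U(1)] U(2) by (rule order_trans)
    finally show ?thesis .
  qed
  then have "emeasure P (\<Inter>n. U n) \<le> 0"
    by (intro LIMSEQ_le_const[OF ennreal_inverse_Suc_tendsto_0]) simp
  then have "(\<Inter>n. U n) \<in> null_sets P"
    using meas by (auto intro: null_setsI)
  then show "AE \<omega> in P. \<phi> \<omega>"
    by (rule AE_I') (use U(3) in auto)
qed

section \<open>Extended-valued quasi-continuity and measurability\<close>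

text \<open>In contrast to \<open>quasi_continuous\<close>, the value \<open>top\<close> is allowed
  off \<open>U\<close>: this is the regularity available before any tail condition makes \<tau>
  finite.\<close>

definition ext_quasi_continuous ::
    "'a::topological_space measure set \<Rightarrow> ('a \<Rightarrow> ennreal) \<Rightarrow> bool" where
  "ext_quasi_continuous \<P> \<tau> \<longleftrightarrow>
     (\<forall>\<delta>::real. \<delta> > 0 \<longrightarrow>
        (\<exists>U. open U \<and> capacity \<P> U \<le> ennreal \<delta> \<and> continuous_on (-U) \<tau>))"

text \<open>Continuity on the closed set \<open>- U n\<close> makes \<tau>, cut off to 0 on
  \<open>U n\<close>, a Borel function. Additivity of integrals needs such a version, since \<tau>
  itself need not be Borel.\<close>

lemma ext_quasi_continuous_borel_version:
  fixes \<tau> :: "'a::topological_space \<Rightarrow> ennreal"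
  assumes prob: "\<P> \<subseteq> prob_measures" and \<tau>: "ext_quasi_continuous \<P> \<tau>"
  obtains T where "T \<in> borel_measurable borel" "quasi_surely \<P> (\<lambda>\<omega>. \<tau> \<omega> = T \<omega>)"
proof -
  have "\<exists>U. open U \<and> capacity \<P> U \<le> ennreal (inverse (real (Suc n))) \<and> continuous_on (-U) \<tau>" for n
    using \<tau> by (simp add: ext_quasi_continuous_def)
  then obtain U where U: "\<And>n. open (U n)"
      "\<And>n. capacity \<P> (U n) \<le> ennreal (inverse (real (Suc n)))" "\<And>n. continuous_on (- U n) \<tau>"
    by metis
  \<comment> \<open>The sets \<open>U n\<close> need not be nested, so a supremum replaces a limit.
    No term exceeds \<tau>, and the n-th term equals \<tau> on \<open>- U n\<close>; on the
    intersection of all \<open>U n\<close> the value is 0.\<close>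
  define T where "T \<omega> = (SUP n. \<tau> \<omega> * indicator (- U n) \<omega>)" for \<omega>
  have "(\<lambda>\<omega>. \<tau> \<omega> * indicator (- U n) \<omega>) \<in> borel_measurable borel" for n
    using borel_measurable_continuous_on_restrict[OF U(3)[of n]] U(1)[of n]
    by (subst (asm) borel_measurable_restrict_space_iff_ennreal) auto
  then have "T \<in> borel_measurable borel"
    unfolding T_def[abs_def] by measurable
  moreover have "quasi_surely \<P> (\<lambda>\<omega>. \<tau> \<omega> = T \<omega>)"
  proof (rule quasi_surely_if_off_small_open[OF prob])
    fix \<delta> :: real assume "\<delta> > 0"
    then obtain n where n: "inverse (real (Suc n)) < \<delta>"
      using reals_Archimedean by blast
    have "\<tau> \<omega> = T \<omega>" if "\<omega> \<in> - U n" for \<omega>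
      unfolding T_def
    proof (rule antisym)
      show "\<tau> \<omega> \<le> (SUP n. \<tau> \<omega> * indicator (- U n) \<omega>)"
        using that by (intro SUP_upper2[of n]) auto
      show "(SUP n. \<tau> \<omega> * indicator (- U n) \<omega>) \<le> \<tau> \<omega>"
        by (intro SUP_least) (auto simp: indicator_def)
    qed
    moreover have "capacity \<P> (U n) \<le> ennreal \<delta>"
      using U(2)[of n] n by (meson ennreal_leI less_imp_le order_trans)
    ultimately show "\<exists>U. open U \<and> capacity \<P> U \<le> ennreal \<delta> \<and> (\<forall>\<omega>\<in>-U. \<tau> \<omega> = T \<omega>)"
      using U(1) by blast
  qed
  ultimately show ?thesis
    by (rule that)
qed

text \<open>The set differs from the Borel set \<open>{\<omega>. T \<omega> > a}\<close> only by a
  null set of \<open>P\<close>. This supplies the measurability required by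
  \<open>capacity_Un_le\<close>.\<close>

lemma ext_quasi_continuous_superlevel_in_completion:
  fixes \<tau> :: "'a::topological_space \<Rightarrow> ennreal"
  assumes prob: "\<P> \<subseteq> prob_measures" and \<tau>: "ext_quasi_continuous \<P> \<tau>" and P: "P \<in> \<P>"
  shows "{\<omega>. \<tau> \<omega> > a} \<in> sets (completion P)"
proof -
  note pD = prob_measuresD[OF prob P]
  obtain T where T: "T \<in> borel_measurable borel" "quasi_surely \<P> (\<lambda>\<omega>. \<tau> \<omega> = T \<omega>)"
    using ext_quasi_continuous_borel_version[OF prob \<tau>] .
  have "{\<omega>. T \<omega> > a} \<in> sets borel"
    using T(1) by measurable
  then have meas: "{\<omega>. T \<omega> > a} \<in> sets (completion P)"
    using pD(2) by (intro sets_completionI_sets) simp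
  have "AE \<omega> in P. \<tau> \<omega> = T \<omega>"
    using T(2) P by (simp add: quasi_surely_def)
  then have ae: "AE \<omega> in P. \<omega> \<in> {\<omega>. T \<omega> > a} \<longleftrightarrow> \<omega> \<in> {\<omega>. \<tau> \<omega> > a}"
    by eventually_elim simp
  show ?thesis
    by (rule completion.in_sets_AE[OF AE_completion[OF ae] meas]) (simp add: pD(3))
qed

section \<open>Quasi-continuity from the tail of the capacity\<close>

lemma quasi_continuous_if_tail_tendsto_0:
  fixes \<tau> :: "'a::topological_space \<Rightarrow> ennreal"
  assumes prob: "\<P> \<subseteq> prob_measures" and \<tau>: "ext_quasi_continuous \<P> \<tau>"
    and tail: "(\<lambda>n::nat. capacity \<P> {\<omega>. \<tau> \<omega> > of_nat n}) \<longlonglongrightarrow> 0"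
  shows "quasi_continuous \<P> (\<lambda>\<omega>. enn2ereal (\<tau> \<omega>))"
  unfolding quasi_continuous_def
proof (intro allI impI)
  fix \<epsilon> :: real assume \<epsilon>: "\<epsilon> > 0"
  have "eventually (\<lambda>n. capacity \<P> {\<omega>. \<tau> \<omega> > of_nat n} < ennreal (\<epsilon>/2)) sequentially"
    using tail by (rule order_tendstoD) (use \<epsilon> in simp)
  then obtain n :: nat where n: "capacity \<P> {\<omega>. \<tau> \<omega> > of_nat n} < ennreal (\<epsilon>/2)"
    by (auto simp: eventually_sequentially)
  obtain U where U: "open U" "capacity \<P> U \<le> ennreal (\<epsilon>/2)" "continuous_on (-U) \<tau>"
    using \<tau> \<epsilon> unfolding ext_quasi_continuous_def by (meson half_gt_zero)
  define V where "V = U \<union> {\<omega>. \<tau> \<omega> > of_nat n}"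
  \<comment> \<open>A relatively closed subset of the closed set \<open>-U\<close> is closed in the
    whole space. The superlevel set alone need not be open; its union with \<open>U\<close>
    is.\<close>
  have "closed (-U \<inter> \<tau> -` {..of_nat n})"
    using U by (intro continuous_closed_preimage) auto
  also have "-U \<inter> \<tau> -` {..of_nat n} = -V"
    by (auto simp: V_def not_less)
  finally have "open V"
    by (simp add: open_closed)
  moreover have "capacity \<P> V < ennreal \<epsilon>"
  proof -
    have "capacity \<P> V \<le> capacity \<P> U + capacity \<P> {\<omega>. \<tau> \<omega> > of_nat n}"
      unfolding V_def
      by (intro capacity_Un_le conjI open_in_completion[OF prob _ U(1)]
            ext_quasi_continuous_superlevel_in_completion[OF prob \<tau>])
    also have "\<dots> < ennreal \<epsilon>"
      using U(2) n by (rule ennreal_add_less_halves)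
    finally show ?thesis .
  qed
  moreover have "\<bar>enn2ereal (\<tau> \<omega>)\<bar> \<noteq> \<infinity>" if "\<omega> \<in> -V" for \<omega>
  proof -
    have "\<tau> \<omega> \<le> of_nat n"
      using that by (simp add: V_def not_less)
    then have "\<tau> \<omega> < top"
      by (rule le_less_trans) (simp add: of_nat_less_top)
    then show ?thesis
      by (cases "\<tau> \<omega>") auto
  qed
  moreover have "continuous_on (-V) (\<lambda>\<omega>. enn2ereal (\<tau> \<omega>))"
    using continuous_on_compose2[OF continuous_on_enn2ereal U(3)]
    by (rule continuous_on_subset) (auto simp: V_def)
  ultimately show "\<exists>U. open U \<and> capacity \<P> U < ennreal \<epsilon> \<and>
      (\<forall>\<omega>\<in>-U. \<bar>enn2ereal (\<tau> \<omega>)\<bar> \<noteq> \<infinity>) \<and> continuous_on (-U) (\<lambda>\<omega>. enn2ereal (\<tau> \<omega>))"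
    by (intro exI[of _ V] conjI ballI)
qed

text \<open>Both finiteness and continuity carry over off the union of the two exceptional sets.
  Agreement is required off open sets because the exceptional set in \<open>quasi_continuous\<close>
  must itself be open.\<close>

lemma quasi_continuous_if_eq_off_small_open:
  assumes prob: "\<P> \<subseteq> prob_measures" and X: "quasi_continuous \<P> X"
    and small: "\<And>\<delta>::real. \<delta> > 0 \<Longrightarrow>
      \<exists>U. open U \<and> capacity \<P> U \<le> ennreal \<delta> \<and> (\<forall>\<omega>\<in>-U. X \<omega> = Z \<omega>)"
  shows "quasi_continuous \<P> Z"
  unfolding quasi_continuous_def
proof (intro allI impI)
  fix \<epsilon> :: real assume \<epsilon>: "\<epsilon> > 0"
  obtain U where U: "open U" "capacity \<P> U < ennreal (\<epsilon>/2)"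
      "\<forall>\<omega>\<in>-U. \<bar>X \<omega>\<bar> \<noteq> \<infinity>" "continuous_on (-U) X"
    using X \<epsilon> unfolding quasi_continuous_def by (meson half_gt_zero)
  obtain V where V: "open V" "capacity \<P> V \<le> ennreal (\<epsilon>/2)" "\<And>\<omega>. \<omega> \<in> -V \<Longrightarrow> X \<omega> = Z \<omega>"
    using small[of "\<epsilon>/2"] \<epsilon> by auto
  have "capacity \<P> (V \<union> U) \<le> capacity \<P> V + capacity \<P> U"
    using U(1) V(1) by (intro capacity_Un_le conjI open_in_completion[OF prob])
  also have "\<dots> < ennreal \<epsilon>"
    using V(2) U(2) by (rule ennreal_add_less_halves)
  finally have "capacity \<P> (V \<union> U) < ennreal \<epsilon>" .
  moreover have "continuous_on (-(V \<union> U)) Z"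
    using continuous_on_subset[OF U(4), of "-(V \<union> U)"] V(3)
    by (subst continuous_on_cong[OF refl, of _ _ X]) auto
  moreover have "\<forall>\<omega>\<in>-(V \<union> U). \<bar>Z \<omega>\<bar> \<noteq> \<infinity>"
    using U(3) V(3) by (metis Compl_Un IntE)
  ultimately show "\<exists>U. open U \<and> capacity \<P> U < ennreal \<epsilon> \<and>
      (\<forall>\<omega>\<in>-U. \<bar>Z \<omega>\<bar> \<noteq> \<infinity>) \<and> continuous_on (-U) Z"
    using U(1) V(1) by blast
qed

section \<open>Membership in the closure of the bounded continuous functions\<close>

text \<open>The function enters \<open>in_L1C\<close> only through its quasi-sure equality with
  \<open>Z\<close>, so the same \<open>Z\<close> and the same approximating sequence serve both
  functions.\<close>

lemma in_L1C_cong_qs: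
  assumes X: "in_L1C \<P> X" and eq: "quasi_surely \<P> (\<lambda>\<omega>. X \<omega> = X' \<omega>)"
  shows "in_L1C \<P> X'"
proof -
  have "quasi_surely \<P> (\<lambda>\<omega>. X' \<omega> = ereal (Z \<omega>))"
    if "quasi_surely \<P> (\<lambda>\<omega>. X \<omega> = ereal (Z \<omega>))" for Z
    using that eq unfolding quasi_surely_def by (auto elim!: AE_mp dest!: bspec)
  with X show ?thesis
    unfolding in_L1C_def by blast
qed

text \<open>Passing to the completion does not change \<open>nn_integral\<close>, so almost sure
  equality under each \<open>P\<close> is enough.\<close>

lemma upper_expectation_cong_qs:
  assumes "quasi_surely \<P> (\<lambda>\<omega>. X \<omega> = Z \<omega>)"
  shows "upper_expectation \<P> X = upper_expectation \<P> Z"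
  unfolding upper_expectation_def nn_integral_completion
  using assms by (intro SUP_cong nn_integral_cong_AE) (auto simp: quasi_surely_def)

lemma nn_integral_le_upper_expectation: "P \<in> \<P> \<Longrightarrow> (\<integral>\<^sup>+\<omega>. X \<omega> \<partial>P) \<le> upper_expectation \<P> X"
  unfolding upper_expectation_def nn_integral_completion by (rule SUP_upper)

lemma upper_expectation_leI:
  "(\<And>P. P \<in> \<P> \<Longrightarrow> (\<integral>\<^sup>+\<omega>. X \<omega> \<partial>P) \<le> C) \<Longrightarrow> upper_expectation \<P> X \<le> C"
  unfolding upper_expectation_def nn_integral_completion by (rule SUP_least)

lemma ext_quasi_continuous_truncation:
  fixes \<tau> :: "'a::metric_space \<Rightarrow> ennreal" and n :: nat
  assumes "open U" "continuous_on (-U) \<tau>"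
  obtains f :: "'a \<Rightarrow> real"
  where "continuous_on UNIV f" "\<And>\<omega>. 0 \<le> f \<omega> \<and> f \<omega> \<le> real n"
    "\<And>\<omega>. \<omega> \<notin> U \<Longrightarrow> f \<omega> = enn2real (min (\<tau> \<omega>) (of_nat n))"
proof -
  let ?g = "\<lambda>\<omega>. enn2real (min (\<tau> \<omega>) (of_nat n))"
  \<comment> \<open>\<open>enn2real\<close> sends \<open>top\<close> to 0 and is not continuous
    there; truncation at a finite level keeps away from this point.\<close>
  have fin: "min (\<tau> \<omega>) (of_nat n) < top" for \<omega>
    by (simp add: min_less_iff_disj of_nat_less_top)
  have "continuous_on (-U) (\<lambda>\<omega>. min (\<tau> \<omega>) (of_nat n))"
    using assms(2) by (intro continuous_intros)
  then have "continuous_on (-U) ?g"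
    unfolding continuous_on_def using fin by (auto intro!: tendsto_enn2real simp: ennreal_enn2real)
  moreover have "?g ` (-U) \<subseteq> {0..real n}"
    using enn2real_mono[OF min.cobounded2 of_nat_less_top, of _ n] by auto
  moreover have "normal_space (euclidean :: 'a topology)"
    by (intro metrizable_imp_normal_space metrizable_space_euclidean)
  moreover have "closedin euclidean (-U)"
    using assms(1) by (simp add: closed_closedin[symmetric] closed_Compl)
  ultimately obtain f where "continuous_map euclidean euclideanreal f"
      "f ` topspace (euclidean :: 'a topology) \<subseteq> {0..real n}" "\<And>\<omega>. \<omega> \<in> -U \<Longrightarrow> f \<omega> = ?g \<omega>"
    using Tietze_extension_realinterval[of euclidean "-U" "{0..real n}" ?g]
    by (metis atLeastatMost_empty_iff2 continuous_map_iff_continuous is_interval_cc of_nat_0_le_iff)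
  then show ?thesis
    by (intro that[of f]) (auto simp: image_subset_iff)
qed

text \<open>Here \<open>u\<close> stands for membership in the exceptional set. If \<open>u\<close>
  fails, the error is the excess of \<open>t\<close> over \<open>n\<close>, at most \<open>t\<close>
  and nonzero only when \<open>t > n\<close>. If \<open>u\<close> holds, the error is at most
  \<open>t\<close> when \<open>t > n\<close>, and otherwise at most \<open>n\<close>, both numbers
  lying in [0,n].\<close>

lemma truncation_error_le:
  fixes t :: ennreal and n :: nat
  assumes "t < top" "0 \<le> y" "y \<le> real n" "\<not> u \<Longrightarrow> y = enn2real (min t (of_nat n))"
  shows "ennreal \<bar>enn2real t - y\<bar> \<le> t * of_bool (t > of_nat n) + of_nat n * of_bool u"
proof -
  obtain r where r: "t = ennreal r" "0 \<le> r"
    using assms(1) by (cases t) auto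
  have *: "ennreal r > of_nat n \<longleftrightarrow> r > real n"
    by (simp add: ennreal_of_nat_eq_real_of_nat ennreal_less_iff)
  have **: "\<not> u \<Longrightarrow> y = min r (real n)"
    using assms(4) r by (auto simp: ennreal_of_nat_eq_real_of_nat min_def)
  show ?thesis
    using assms(2,3) r ** unfolding r(1) *
    by (auto simp: ennreal_of_nat_eq_real_of_nat simp flip: ennreal_plus intro!: ennreal_leI)
qed

lemma in_L1C_if_tail_expectation_tendsto_0:
  fixes \<tau> :: "'a::metric_space \<Rightarrow> ennreal"
  assumes prob: "\<P> \<subseteq> prob_measures" and \<tau>: "ext_quasi_continuous \<P> \<tau>"
    and tail: "(\<lambda>n::nat. upper_expectation \<P> (\<lambda>\<omega>. \<tau> \<omega> * indicator {\<omega>. \<tau> \<omega> > of_nat n} \<omega>)) \<longlonglongrightarrow> 0"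
  shows "in_L1C \<P> (\<lambda>\<omega>. enn2ereal (\<tau> \<omega>))"
proof -
  obtain T where T [measurable]: "T \<in> borel_measurable borel"
    and eq: "quasi_surely \<P> (\<lambda>\<omega>. \<tau> \<omega> = T \<omega>)"
    using ext_quasi_continuous_borel_version[OF prob \<tau>] .
  \<comment> \<open>The tail expectation is rewritten for the Borel version \<open>T\<close>, so
    that the integrals below can be split into sums.\<close>
  define e where "e n = upper_expectation \<P> (\<lambda>\<omega>. T \<omega> * of_bool (T \<omega> > of_nat n))" for n :: nat
  have "upper_expectation \<P> (\<lambda>\<omega>. \<tau> \<omega> * indicator {\<omega>. \<tau> \<omega> > of_nat n} \<omega>) = e n" for n :: nat
    unfolding e_def
    by (rule upper_expectation_cong_qs)
      (use eq in \<open>auto simp: quasi_surely_def indicator_def of_bool_def elim!: AE_mp\<close>)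
  with tail have e: "e \<longlonglongrightarrow> 0"
    by simp
  have e_le: "(\<integral>\<^sup>+\<omega>. T \<omega> * of_bool (T \<omega> > of_nat n) \<partial>P) \<le> e n" if "P \<in> \<P>" for P n
    unfolding e_def using that by (rule nn_integral_le_upper_expectation)
  have e_small: "\<exists>n. e n < ennreal \<epsilon>" if "\<epsilon> > 0" for \<epsilon>
    using order_tendstoD(2)[OF e, of "ennreal \<epsilon>"] that by (auto simp: eventually_sequentially)
  have meas: "f \<in> borel_measurable P" if "P \<in> \<P>" "f \<in> borel_measurable borel"
    for P and f :: "'a \<Rightarrow> ennreal"
    using that(2) measurable_cong_sets[OF prob_measuresD(2)[OF prob that(1)] refl] by blast
  \<comment> \<open>A single tail below 1 yields the bound m + 1 on the integral of
    \<open>T\<close>, uniformly in \<open>P\<close>; it gives both almost sure finiteness and finite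
    norm.\<close>
  obtain m where m: "e m < ennreal 1"
    using e_small[of 1] by auto
  have T_bound: "(\<integral>\<^sup>+\<omega>. T \<omega> \<partial>P) \<le> of_nat m + 1" if P: "P \<in> \<P>" for P
  proof -
    interpret prob_space P
      using prob_measuresD(1)[OF prob P] .
    have "(\<integral>\<^sup>+\<omega>. T \<omega> \<partial>P) \<le> (\<integral>\<^sup>+\<omega>. of_nat m + T \<omega> * of_bool (T \<omega> > of_nat m) \<partial>P)"
      by (intro nn_integral_mono) (auto simp: of_bool_def not_less intro: add_increasing)
    also have "\<dots> = of_nat m + (\<integral>\<^sup>+\<omega>. T \<omega> * of_bool (T \<omega> > of_nat m) \<partial>P)"
      by (subst nn_integral_add) (auto simp: emeasure_space_1 intro!: meas[OF P])
    also have "\<dots> \<le> of_nat m + 1"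
      using order_trans[OF e_le[OF P] less_imp_le[OF m]] by (intro add_left_mono) simp
    finally show ?thesis .
  qed
  have fin: "AE \<omega> in P. T \<omega> < top" if P: "P \<in> \<P>" for P
  proof -
    have "(\<integral>\<^sup>+\<omega>. T \<omega> \<partial>P) < top"
      using T_bound[OF P] by (rule le_less_trans) (simp add: of_nat_less_top)
    then show ?thesis
      using nn_integral_PInf_AE[OF meas[OF P T]] by (simp add: less_top)
  qed
  \<comment> \<open>Where \<open>T\<close> is \<open>top\<close> the default value 0 is taken; by
    \<open>fin\<close> this happens only on a null set of each \<open>P\<close>.\<close>
  define Z where "Z \<omega> = enn2real (T \<omega>)" for \<omega>
  have Z [measurable]: "Z \<in> borel_measurable borel"
    unfolding Z_def[abs_def] by measurable
  have "quasi_surely \<P> (\<lambda>\<omega>. enn2ereal (\<tau> \<omega>) = ereal (Z \<omega>))"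
    unfolding quasi_surely_def
  proof
    fix P assume P: "P \<in> \<P>"
    have "AE \<omega> in P. \<tau> \<omega> = T \<omega>"
      using eq P by (simp add: quasi_surely_def)
    then show "AE \<omega> in P. enn2ereal (\<tau> \<omega>) = ereal (Z \<omega>)"
      using fin[OF P]
    proof eventually_elim
      case (elim \<omega>)
      then show ?case
        by (cases "T \<omega>") (auto simp: Z_def)
    qed
  qed
  moreover have "upper_expectation \<P> (\<lambda>\<omega>. ennreal \<bar>Z \<omega>\<bar>) < \<infinity>"
  proof -
    have "(\<integral>\<^sup>+\<omega>. ennreal \<bar>Z \<omega>\<bar> \<partial>P) \<le> of_nat m + 1" if P: "P \<in> \<P>" for P
    proof -
      have "(\<integral>\<^sup>+\<omega>. ennreal \<bar>Z \<omega>\<bar> \<partial>P) \<le> (\<integral>\<^sup>+\<omega>. T \<omega> \<partial>P)"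
        using fin[OF P] by (intro nn_integral_mono_AE, eventually_elim) (simp add: Z_def)
      with T_bound[OF P] show ?thesis
        by (rule order_trans[rotated])
    qed
    then have "upper_expectation \<P> (\<lambda>\<omega>. ennreal \<bar>Z \<omega>\<bar>) \<le> of_nat m + 1"
      by (rule upper_expectation_leI)
    then show ?thesis
      by (rule le_less_trans) (simp add: of_nat_less_top)
  qed
  moreover have approx: "\<exists>f. continuous_on UNIV f \<and> bounded (range f) \<and>
      upper_expectation \<P> (\<lambda>\<omega>. ennreal \<bar>Z \<omega> - f \<omega>\<bar>) \<le> ennreal \<epsilon>" if \<epsilon>: "\<epsilon> > 0" for \<epsilon> :: real
  proof -
    obtain n where n: "e n < ennreal (\<epsilon>/2)"
      using e_small[of "\<epsilon>/2"] \<epsilon> by auto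
    \<comment> \<open>The truncation level \<open>n\<close> is fixed before \<open>U\<close>, so
      that \<delta> can absorb the factor \<open>n\<close> multiplying the measure of
      \<open>U\<close>: n\<delta> is at most \<epsilon>/2. Dividing by \<open>Suc n\<close> covers n
      = 0.\<close>
    define \<delta> where "\<delta> = \<epsilon> / 2 / real (Suc n)"
    have "\<delta> > 0"
      using \<epsilon> by (simp add: \<delta>_def)
    then obtain U where U: "open U" "capacity \<P> U \<le> ennreal \<delta>" "continuous_on (-U) \<tau>"
      using \<tau> unfolding ext_quasi_continuous_def by blast
    obtain f where f: "continuous_on UNIV f" "\<And>\<omega>. 0 \<le> f \<omega> \<and> f \<omega> \<le> real n"
        "\<And>\<omega>. \<omega> \<notin> U \<Longrightarrow> f \<omega> = enn2real (min (\<tau> \<omega>) (of_nat n))"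
      using ext_quasi_continuous_truncation[OF U(1,3)] by metis
    have "bounded (range f)"
      using f(2) by (intro boundedI[of _ "real n"]) auto
    moreover have "(\<integral>\<^sup>+\<omega>. ennreal \<bar>Z \<omega> - f \<omega>\<bar> \<partial>P) \<le> ennreal \<epsilon>" if P: "P \<in> \<P>" for P
    proof -
      have U_P: "U \<in> sets P"
        using prob_measuresD[OF prob P] U(1) by auto
      \<comment> \<open>Off \<open>U\<close>, \<open>f\<close> is a truncation of \<tau>, whereas
        \<open>Z\<close> comes from \<open>T\<close>; identifying the two almost surely makes the
        pointwise error bound applicable.\<close>
      have "AE \<omega> in P. \<tau> \<omega> = T \<omega>"
        using eq P by (simp add: quasi_surely_def)
      then have "AE \<omega> in P. ennreal \<bar>Z \<omega> - f \<omega>\<bar>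
          \<le> T \<omega> * of_bool (T \<omega> > of_nat n) + of_nat n * indicator U \<omega>"
        using fin[OF P]
      proof eventually_elim
        case (elim \<omega>)
        then show ?case
          using truncation_error_le[of "T \<omega>" "f \<omega>" n "\<omega> \<in> U"] f(2,3)[of \<omega>]
          by (auto simp: Z_def indicator_def)
      qed
      then have "(\<integral>\<^sup>+\<omega>. ennreal \<bar>Z \<omega> - f \<omega>\<bar> \<partial>P)
          \<le> (\<integral>\<^sup>+\<omega>. T \<omega> * of_bool (T \<omega> > of_nat n) + of_nat n * indicator U \<omega> \<partial>P)"
        by (rule nn_integral_mono_AE)
      also have "\<dots> = (\<integral>\<^sup>+\<omega>. T \<omega> * of_bool (T \<omega> > of_nat n) \<partial>P) + of_nat n * emeasure P U"
        using U_P by (subst nn_integral_add) (auto simp: nn_integral_cmult_indicator intro!: meas[OF P])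
      also have "\<dots> \<le> ennreal (\<epsilon>/2) + of_nat n * ennreal \<delta>"
        by (intro add_mono mult_left_mono order_trans[OF e_le[OF P] less_imp_le[OF n]]
            order_trans[OF emeasure_open_le_capacity[OF prob P U(1)] U(2)]) simp
      also have "\<dots> = ennreal (\<epsilon>/2 + real n * \<delta>)"
        using \<epsilon> \<open>\<delta> > 0\<close> by (simp add: ennreal_of_nat_eq_real_of_nat ennreal_mult ennreal_plus)
      also have "\<dots> \<le> ennreal \<epsilon>"
        using \<epsilon> by (intro ennreal_leI) (auto simp: \<delta>_def field_simps)
      finally show ?thesis .
    qed
    then have "upper_expectation \<P> (\<lambda>\<omega>. ennreal \<bar>Z \<omega> - f \<omega>\<bar>) \<le> ennreal \<epsilon>"
      by (rule upper_expectation_leI)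
    ultimately show ?thesis
      using f(1) by blast
  qed
  have "\<exists>f :: nat \<Rightarrow> 'a \<Rightarrow> real. (\<forall>n. continuous_on UNIV (f n) \<and> bounded (range (f n))) \<and>
      (\<lambda>n. upper_expectation \<P> (\<lambda>\<omega>. ennreal \<bar>Z \<omega> - f n \<omega>\<bar>)) \<longlonglongrightarrow> 0"
  proof -
    have "\<exists>f. continuous_on UNIV f \<and> bounded (range f) \<and>
        upper_expectation \<P> (\<lambda>\<omega>. ennreal \<bar>Z \<omega> - f \<omega>\<bar>) \<le> ennreal (inverse (real (Suc n)))" for n
      by (rule approx) simp
    then obtain f where f: "\<And>n. continuous_on UNIV (f n)" "\<And>n. bounded (range (f n))"
        "\<And>n. upper_expectation \<P> (\<lambda>\<omega>. ennreal \<bar>Z \<omega> - f n \<omega>\<bar>) \<le> ennreal (inverse (real (Suc n)))"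
      by metis
    have "(\<lambda>n. upper_expectation \<P> (\<lambda>\<omega>. ennreal \<bar>Z \<omega> - f n \<omega>\<bar>)) \<longlonglongrightarrow> 0"
      by (rule tendsto_sandwich[OF _ _ tendsto_const ennreal_inverse_Suc_tendsto_0])
        (simp_all add: f(3) del: of_nat_Suc)
    with f(1,2) show ?thesis
      by blast
  qed
  ultimately show ?thesis
    unfolding in_L1C_def using Z by blast
qed

section \<open>Application to the exit times\<close>

theorem theorem3p16:
  fixes \<P> :: "('k::finite) path measure set"
    and Y :: "real \<Rightarrow> 'k path \<Rightarrow> real^('d::finite)"
    and Q :: "(real^'d) set"
  assumes "weakly_compact \<P>"
    and "continuous_family_semimartingale \<P> Y"
    and "open Q"
    and "\<And>\<delta>::real. \<delta> > 0 \<Longrightarrow>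
           \<exists>U. open U \<and> capacity \<P> U \<le> ennreal \<delta> \<and>
               lower_semicontinuous_on (-U) (exit_time Y Q) \<and>
               upper_semicontinuous_on (-U) (exit_time Y (closure Q)) \<and>
               (\<forall>\<omega>\<in>-U. exit_time Y Q \<omega> = exit_time Y (closure Q) \<omega>)"
  shows "((\<lambda>n::nat. capacity \<P> {\<omega>. exit_time Y (closure Q) \<omega> > of_nat n}) \<longlonglongrightarrow> 0 \<longrightarrow>
            quasi_continuous \<P> (\<lambda>\<omega>. enn2ereal (exit_time Y Q \<omega>)) \<and>
            quasi_continuous \<P> (\<lambda>\<omega>. enn2ereal (exit_time Y (closure Q) \<omega>)))
       \<and> ((\<lambda>n::nat. upper_expectation \<P> (\<lambda>\<omega>. exit_time Y (closure Q) \<omega> *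
              indicator {\<omega>. exit_time Y (closure Q) \<omega> > of_nat n} \<omega>)) \<longlonglongrightarrow> 0 \<longrightarrow>
            in_L1C \<P> (\<lambda>\<omega>. enn2ereal (exit_time Y Q \<omega>)) \<and>
            in_L1C \<P> (\<lambda>\<omega>. enn2ereal (exit_time Y (closure Q) \<omega>)))"
proof -
  let ?\<tau> = "exit_time Y Q" and ?\<tau>' = "exit_time Y (closure Q)"
  note prob = weakly_compact_imp_prob_measures[OF assms(1)]
  \<comment> \<open>Each exit time brings one half of continuity; since they coincide on
    \<open>-U\<close>, both halves can be placed on \<open>?\<tau>\<close>, and the resulting
    continuity is moved to \<open>?\<tau>'\<close>.\<close>
  have "continuous_on (-U) ?\<tau>'"
    if "lower_semicontinuous_on (-U) ?\<tau>" "upper_semicontinuous_on (-U) ?\<tau>'"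
      "\<forall>\<omega>\<in>-U. ?\<tau> \<omega> = ?\<tau>' \<omega>" for U
  proof -
    have "upper_semicontinuous_on (-U) ?\<tau>"
      using that(2) by (rule upper_semicontinuous_on_cong) (use that(3) in simp)
    with that(1) have "continuous_on (-U) ?\<tau>"
      by (rule continuous_on_if_semicontinuous)
    then show ?thesis
      by (rule continuous_on_eq) (use that(3) in simp)
  qed
  then have cont: "ext_quasi_continuous \<P> ?\<tau>'"
    unfolding ext_quasi_continuous_def using assms(4) by meson
  \<comment> \<open>The tail conditions concern \<open>?\<tau>'\<close>, so the conclusions are
    first obtained for it and then transferred to \<open>?\<tau>\<close> by this agreement.\<close>
  have agree: "\<exists>U. open U \<and> capacity \<P> U \<le> ennreal \<delta> \<and> (\<forall>\<omega>\<in>-U. enn2ereal (?\<tau>' \<omega>) = enn2ereal (?\<tau> \<omega>))"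
    if "\<delta> > 0" for \<delta> :: real
    using assms(4)[OF that] by metis
  show ?thesis
    using quasi_continuous_if_tail_tendsto_0[OF prob cont]
      quasi_continuous_if_eq_off_small_open[OF prob _ agree]
      in_L1C_if_tail_expectation_tendsto_0[OF prob cont]
      in_L1C_cong_qs[OF _ quasi_surely_if_off_small_open[OF prob agree]]
    by simp
qed

end
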